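(* Let $k$ be a field, let $R = k[x_1,\ldots,x_n]$ with its standard grading, and let $I$ be a graded (homogeneous) ideal of $R$. Let $\operatorname{mono}(I)$ denote the ideal generated by all monomials contained in $I$. Then $I$ is Artinian if and only if $\operatorname{mono}(I)$ is Artinian. In this case, $\operatorname{reg}(R/I) = \operatorname{reg}(R/\operatorname{mono}(I))$.
   Context: Let $\mathfrak{m} = (x_1,\ldots,x_n)$. A graded ideal $J\subseteq R$ is called Artinian if it is $\mathfrak{m}$-primary, i.e. $J$ is proper and $R/J$ is an Artinian ring. $\operatorname{reg}$ denotes Castelnuovo–Mumford regularity; for a nonzero Artinian graded module $M = \bigoplus_i M_i$ one has $\operatorname{reg} M = \max\{i \mid M_i \neq 0\}$. *)

theory Defs
  imports
    Complex_Main
    "HOL-Library.Poly_Mapping"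
    "HOL-Library.Extended_Real"
    "HOL-Library.FuncSet"
    "HOL-Algebra.Module"
    "HOL-Algebra.QuotRing"
begin

text \<open>
  An exponent vector is a finitely supported function on \<open>nat\<close>; the variables
  \<open>x\<^sub>1, \<dots>, x\<^sub>n\<close> are the indeterminates with indices \<open>0, \<dots>, n - 1\<close>.
\<close>

type_synonym 'k mpoly = "(nat \<Rightarrow>\<^sub>0 nat) \<Rightarrow>\<^sub>0 'k"

definition poly_ring :: "nat \<Rightarrow> 'k::field mpoly ring" where
  "poly_ring n =
     \<lparr>carrier = {p. \<forall>m \<in> Poly_Mapping.keys p. Poly_Mapping.keys m \<subseteq> {..<n}},
      mult = (*), one = 1, zero = 0, add = (+)\<rparr>"

definition var :: "nat \<Rightarrow> 'k::field mpoly" where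
  "var i = Poly_Mapping.single (Poly_Mapping.single i 1) 1"

definition total_degree :: "(nat \<Rightarrow>\<^sub>0 nat) \<Rightarrow> nat" where
  "total_degree m = (\<Sum>i \<in> Poly_Mapping.keys m. Poly_Mapping.lookup m i)"

definition poly_comp :: "nat \<Rightarrow> int \<Rightarrow> 'k::field mpoly set" where
  "poly_comp n d = {p \<in> carrier (poly_ring n).
     \<forall>m \<in> Poly_Mapping.keys p. int (total_degree m) = d}"

definition hom_part :: "nat \<Rightarrow> 'k::field mpoly \<Rightarrow> 'k mpoly" where
  "hom_part d p =
     (\<Sum>m \<in> {m \<in> Poly_Mapping.keys p. total_degree m = d}.
        Poly_Mapping.single m (Poly_Mapping.lookup p m))"

definition graded_ideal :: "nat \<Rightarrow> 'k::field mpoly set \<Rightarrow> bool" where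
  "graded_ideal n I \<longleftrightarrow> ideal I (poly_ring n) \<and> (\<forall>p \<in> I. \<forall>d. hom_part d p \<in> I)"

definition monomial :: "'k::field mpoly \<Rightarrow> bool" where
  "monomial p \<longleftrightarrow> (\<exists>m. p = Poly_Mapping.single m 1)"

definition mono_ideal :: "nat \<Rightarrow> 'k::field mpoly set \<Rightarrow> 'k mpoly set" where
  "mono_ideal n I = Idl\<^bsub>poly_ring n\<^esub> {p \<in> I. monomial p}"

definition artinian_ring :: "('a, 'b) ring_scheme \<Rightarrow> bool" where
  "artinian_ring A \<longleftrightarrow> cring A \<and>
     (\<forall>C :: nat \<Rightarrow> 'a set. (\<forall>i. ideal (C i) A \<and> C (Suc i) \<subseteq> C i)
        \<longrightarrow> (\<exists>N. \<forall>i \<ge> N. C i = C N))"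

text \<open>
  For a graded ideal this is equivalent to being primary to \<open>(x\<^sub>1, \<dots>, x\<^sub>n)\<close>.
\<close>

definition artinian_ideal :: "nat \<Rightarrow> 'k::field mpoly set \<Rightarrow> bool" where
  "artinian_ideal n J \<longleftrightarrow>
     ideal J (poly_ring n) \<and> J \<noteq> carrier (poly_ring n) \<and> artinian_ring (poly_ring n Quot J)"

record ('a, 'b) graded_module = "('a, 'b) module" +
  gr_comp :: "int \<Rightarrow> 'b set"

text \<open>The \<open>mult\<close> and \<open>one\<close> fields that modules inherit from rings play no role below.\<close>

definition quot_module :: "nat \<Rightarrow> 'k::field mpoly set \<Rightarrow> ('k mpoly, 'k mpoly set) graded_module" where
  "quot_module n J =
     \<lparr>carrier = carrier (poly_ring n Quot J), mult = mult (poly_ring n Quot J),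
      one = one (poly_ring n Quot J), zero = zero (poly_ring n Quot J),
      add = add (poly_ring n Quot J),
      smult = (\<lambda>p X. (J +>\<^bsub>poly_ring n\<^esub> p) \<otimes>\<^bsub>poly_ring n Quot J\<^esub> X),
      gr_comp = (\<lambda>d. (\<lambda>p. J +>\<^bsub>poly_ring n\<^esub> p) ` poly_comp n d)\<rparr>"

text \<open>
  Elements of the localization \<open>M\<^sub>f\<close> are classes of pairs \<open>(u, k)\<close>, standing for the
  fractions \<open>u / f\<^sup>k\<close>.
\<close>

definition frac_class ::
    "('a, 'r) ring_scheme \<Rightarrow> ('a, 'b, 'm) module_scheme \<Rightarrow> 'a \<Rightarrow> 'b \<Rightarrow> nat \<Rightarrow> ('b \<times> nat) set" where
  "frac_class R M f u k = {(v, l). v \<in> carrier M \<and>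
     (\<exists>t. (f [^]\<^bsub>R\<^esub> (t + l)) \<odot>\<^bsub>M\<^esub> u = (f [^]\<^bsub>R\<^esub> (t + k)) \<odot>\<^bsub>M\<^esub> v)}"

text \<open>
  The unions over representatives are unions of copies of one and the same class.
  In the grading, \<open>e\<close> is the degree of the homogeneous element \<open>f\<close>.
\<close>

definition localization ::
    "('a, 'r) ring_scheme \<Rightarrow> ('a, 'b, 'm) graded_module_scheme \<Rightarrow> 'a \<Rightarrow> nat
      \<Rightarrow> ('a, ('b \<times> nat) set) graded_module" where
  "localization R M f e =
     \<lparr>carrier = {frac_class R M f u k | u k. u \<in> carrier M},
      mult = undefined, one = undefined,
      zero = frac_class R M f \<zero>\<^bsub>M\<^esub> 0,
      add = (\<lambda>X Y. \<Union>(u, k) \<in> X. \<Union>(v, l) \<in> Y.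
               frac_class R M f (((f [^]\<^bsub>R\<^esub> l) \<odot>\<^bsub>M\<^esub> u) \<oplus>\<^bsub>M\<^esub> ((f [^]\<^bsub>R\<^esub> k) \<odot>\<^bsub>M\<^esub> v)) (k + l)),
      smult = (\<lambda>p X. \<Union>(u, k) \<in> X. frac_class R M f (p \<odot>\<^bsub>M\<^esub> u) k),
      gr_comp = (\<lambda>j. {frac_class R M f u k | u k. u \<in> gr_comp M (j + int (e * k))})\<rparr>"

text \<open>
  The local cohomology of a graded module \<open>M\<close> over \<open>k[x\<^sub>1, \<dots>, x\<^sub>n]\<close> with support in
  \<open>(x\<^sub>1, \<dots>, x\<^sub>n)\<close> is the cohomology of its Cech complex, whose term in cohomological degree \<open>i\<close>
  is the direct sum of the localizations of \<open>M\<close> at the products of the variables indexed by \<open>S\<close>,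
  over all \<open>S\<close> with \<open>i\<close> elements.  The complex is graded; everything below is relative to a fixed
  internal degree \<open>j\<close>.
\<close>

definition faces :: "nat \<Rightarrow> nat \<Rightarrow> nat set set" where
  "faces n i = {S. S \<subseteq> {..<n} \<and> card S = i}"

definition cech_loc ::
    "nat \<Rightarrow> ('k::field mpoly, 'b, 'm) graded_module_scheme \<Rightarrow> nat set
      \<Rightarrow> ('k mpoly, ('b \<times> nat) set) graded_module" where
  "cech_loc n M S = localization (poly_ring n) M (\<Prod>i \<in> S. var i) (card S)"

text \<open>For \<open>s \<in> T\<close>, the natural map from the localization at \<open>T - {s}\<close> to the one at \<open>T\<close>.\<close>

definition cech_res ::
    "nat \<Rightarrow> ('k::field mpoly, 'b, 'm) graded_module_scheme \<Rightarrow> nat set \<Rightarrow> nat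
      \<Rightarrow> ('b \<times> nat) set \<Rightarrow> ('b \<times> nat) set" where
  "cech_res n M T s X =
     (\<Union>(u, k) \<in> X. frac_class (poly_ring n) M (\<Prod>i \<in> T. var i) ((var s ^ k) \<odot>\<^bsub>M\<^esub> u) k)"

definition cech_cochains ::
    "nat \<Rightarrow> ('k::field mpoly, 'b, 'm) graded_module_scheme \<Rightarrow> nat \<Rightarrow> int
      \<Rightarrow> (nat set \<Rightarrow> ('b \<times> nat) set) set" where
  "cech_cochains n M i j = (\<Pi>\<^sub>E S \<in> faces n i. gr_comp (cech_loc n M S) j)"

definition cech_d ::
    "nat \<Rightarrow> ('k::field mpoly, 'b, 'm) graded_module_scheme \<Rightarrow> nat
      \<Rightarrow> (nat set \<Rightarrow> ('b \<times> nat) set) \<Rightarrow> nat set \<Rightarrow> ('b \<times> nat) set" where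
  "cech_d n M i c =
     (\<lambda>T \<in> faces n (Suc i). \<Oplus>\<^bsub>cech_loc n M T\<^esub>s \<in> T.
        ((- 1) ^ card {t \<in> T. t < s}) \<odot>\<^bsub>cech_loc n M T\<^esub> cech_res n M T s (c (T - {s})))"

definition cech_zero ::
    "nat \<Rightarrow> ('k::field mpoly, 'b, 'm) graded_module_scheme \<Rightarrow> nat \<Rightarrow> nat set \<Rightarrow> ('b \<times> nat) set" where
  "cech_zero n M i = (\<lambda>S \<in> faces n i. \<zero>\<^bsub>cech_loc n M S\<^esub>)"

definition cech_cocycles ::
    "nat \<Rightarrow> ('k::field mpoly, 'b, 'm) graded_module_scheme \<Rightarrow> nat \<Rightarrow> int
      \<Rightarrow> (nat set \<Rightarrow> ('b \<times> nat) set) ring" where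
  "cech_cocycles n M i j =
     \<lparr>carrier = {c \<in> cech_cochains n M i j. cech_d n M i c = cech_zero n M (Suc i)},
      mult = undefined, one = undefined,
      zero = cech_zero n M i,
      add = (\<lambda>c c'. \<lambda>S \<in> faces n i. c S \<oplus>\<^bsub>cech_loc n M S\<^esub> c' S)\<rparr>"

definition cech_coboundaries ::
    "nat \<Rightarrow> ('k::field mpoly, 'b, 'm) graded_module_scheme \<Rightarrow> nat \<Rightarrow> int
      \<Rightarrow> (nat set \<Rightarrow> ('b \<times> nat) set) set" where
  "cech_coboundaries n M i j =
     (case i of 0 \<Rightarrow> {cech_zero n M 0} | Suc i' \<Rightarrow> cech_d n M i' ` cech_cochains n M i' j)"

definition local_cohomology ::
    "nat \<Rightarrow> ('k::field mpoly, 'b, 'm) graded_module_scheme \<Rightarrow> nat \<Rightarrow> int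
      \<Rightarrow> (nat set \<Rightarrow> ('b \<times> nat) set) set monoid" where
  "local_cohomology n M i j = cech_cocycles n M i j A_Mod cech_coboundaries n M i j"

text \<open>
  The regularity is the largest \<open>i + j\<close> such that the \<open>i\<close>-th local cohomology module of \<open>M\<close> is
  nonzero in degree \<open>j\<close>.  Extended reals cover the usual convention that the zero module
  has regularity \<open>-\<infinity>\<close>; for a finitely generated nonzero module the
  supremum is a maximum.
\<close>

definition regularity ::
    "nat \<Rightarrow> ('k::field mpoly, 'b, 'm) graded_module_scheme \<Rightarrow> ereal" where
  "regularity n M =
     (SUP (i, j) \<in> {(i, j). carrier (local_cohomology n M i j)
                              \<noteq> {\<one>\<^bsub>local_cohomology n M i j\<^esub>}}.
        ereal (of_int (int i + j)))"

end

theory Submission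
  imports Defs
begin

text \<open>
  If \<open>J \<subseteq> I\<close> with \<open>R/J\<close> Artinian and \<open>I\<close> graded, the chain of the ideals \<open>J + \<mm>\<^sup>d\<close> becomes
  stationary, so a monomial of large degree \<open>d\<close> lies in \<open>J + \<mm>\<^bsup>d+1\<^esup>\<close>; comparing parts of degree
  \<open>d\<close> puts it into \<open>I\<close>.  Taking \<open>J = I\<close> or \<open>J = mono(I)\<close>, either quotient being Artinian means
  that \<open>I\<close>, or equivalently \<open>mono(I)\<close>, contains all monomials of large degree; conversely the
  quotient is then finite-dimensional.  In this situation every localization in the Cech complex
  except the one at the empty face vanishes, so the regularity is the largest degree \<open>d\<close> in which
  some monomial lies outside the ideal, and \<open>I\<close> and \<open>mono(I)\<close> contain the same monomials.
\<close>


section \<open>Subspaces of a finitely spanned subspace\<close>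

text \<open>A basis of \<open>V\<close> extends to a basis of \<open>W\<close>, which is finite
  because it is independent inside the span of \<open>B\<close>; the dimension inequality leaves no
  room for new vectors. Finiteness is carried by \<open>B\<close>, as the ambient space may have
  infinite dimension.\<close>

lemma (in vector_space) subspace_eqI_dim:
  assumes "subspace V" "V \<subseteq> W" "subspace W" "W \<subseteq> span B" "finite B" "dim W \<le> dim V"
  shows "V = W"
proof -
  obtain A where A: "A \<subseteq> V" "independent A" "V \<subseteq> span A"
    using maximal_independent_subset by blast
  obtain A' where A': "A \<subseteq> A'" "A' \<subseteq> W" "independent A'" "W \<subseteq> span A'"
    using maximal_independent_subset_extend[of A W] A assms(2) by blast
  have "finite A'"
    using independent_span_bound[of B A'] assms(4,5) A' by blast
  moreover have "card A' \<le> card A"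
    using basis_card_eq_dim[of A V] basis_card_eq_dim[of A' W] A A' assms(6) by simp
  ultimately have "A = A'"
    using A'(1) card_seteq by blast
  then show ?thesis
    using A A' assms span_minimal[of A V] by blast
qed

text \<open>At an index \<open>N\<close> of least dimension, every later subspace lies in
  \<open>U N\<close> and has at least its dimension, so the two agree.\<close>

lemma (in vector_space) descending_subspaces_stationary:
  fixes U :: "nat \<Rightarrow> 'b set"
  assumes sub: "\<And>i. subspace (U i)" and desc: "\<And>i. U (Suc i) \<subseteq> U i"
    and B: "U 0 \<subseteq> span B" "finite B"
  shows "\<exists>N. \<forall>i \<ge> N. U i = U N"
proof -
  obtain N where N: "\<And>i. dim (U N) \<le> dim (U i)"
    using ex_has_least_nat[of "\<lambda>_. True" 0 "\<lambda>i. dim (U i)"] by blast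
  have mono: "U i \<subseteq> U j" if "j \<le> i" for i j
    using lift_Suc_antimono_le[of U] desc that by blast
  show ?thesis
    using subspace_eqI_dim[OF sub _ sub _ B(2) N] mono B(1) by (meson le0 order_trans)
qed

section \<open>Polynomials, degrees and ideals in k[x_1, ..., x_n]\<close>

lemma carrier_poly_ring:
  "p \<in> carrier (poly_ring n) \<longleftrightarrow>
    (\<forall>m \<in> Poly_Mapping.keys p. Poly_Mapping.keys m \<subseteq> {..<n})"
  by (simp add: poly_ring_def)

lemma poly_ring_simps [simp]:
  "mult (poly_ring n) = (*)" "one (poly_ring n) = 1" "zero (poly_ring n) = 0"
  "add (poly_ring n) = (+)"
  by (simp_all add: poly_ring_def)

text \<open>Exponents are natural numbers, so nothing cancels in a sum.\<close>

lemma keys_add_nat: "Poly_Mapping.keys (a + b) = Poly_Mapping.keys a \<union> Poly_Mapping.keys b"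
  for a b :: "nat \<Rightarrow>\<^sub>0 nat"
  by (auto simp: in_keys_iff lookup_add)

lemma total_degree_add: "total_degree (a + b) = total_degree a + total_degree b"
proof -
  \<comment> \<open>All three degrees become sums over one index set; the added indices contribute
    zero.\<close>
  have *: "total_degree m = (\<Sum>i \<in> Poly_Mapping.keys a \<union> Poly_Mapping.keys b. Poly_Mapping.lookup m i)"
    if "Poly_Mapping.keys m \<subseteq> Poly_Mapping.keys a \<union> Poly_Mapping.keys b" for m
    unfolding total_degree_def using that
    by (intro sum.mono_neutral_left) (auto simp: in_keys_iff)
  show ?thesis
    by (simp add: * keys_add_nat lookup_add sum.distrib)
qed

lemma cring_poly_ring: "cring (poly_ring n :: 'k::field mpoly ring)"
proof (rule cringI)
  have add: "p + q \<in> carrier (poly_ring n)"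
    if "p \<in> carrier (poly_ring n)" "q \<in> carrier (poly_ring n)" for p q :: "'k mpoly"
    using that keys_add[of p q] by (auto simp: carrier_poly_ring)
  show "abelian_group (poly_ring n :: 'k mpoly ring)"
  proof (rule abelian_groupI)
    show "\<exists>q \<in> carrier (poly_ring n). q \<oplus>\<^bsub>poly_ring n\<^esub> p = \<zero>\<^bsub>poly_ring n\<^esub>"
      if "p \<in> carrier (poly_ring n)" for p :: "'k mpoly"
      using that by (intro bexI[of _ "- p"]) (auto simp: carrier_poly_ring)
    show "p \<oplus>\<^bsub>poly_ring n\<^esub> q \<in> carrier (poly_ring n)"
      if "p \<in> carrier (poly_ring n)" "q \<in> carrier (poly_ring n)" for p q :: "'k mpoly"
      using add[OF that] by simp
  qed (simp_all add: carrier_poly_ring add_ac)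
  show "comm_monoid (poly_ring n :: 'k mpoly ring)"
  proof (rule comm_monoidI)
    show "p \<otimes>\<^bsub>poly_ring n\<^esub> q \<in> carrier (poly_ring n)"
      if "p \<in> carrier (poly_ring n)" "q \<in> carrier (poly_ring n)" for p q :: "'k mpoly"
      using that keys_mult[of p q] unfolding carrier_poly_ring poly_ring_simps
      by (fastforce simp: keys_add_nat)
  qed (simp_all add: carrier_poly_ring mult_ac)
qed (simp_all add: algebra_simps)

lemma nat_pow_poly_ring [simp]: "p [^]\<^bsub>poly_ring n\<^esub> (t::nat) = p ^ t"
  by (induction t) (simp_all add: cring.cring_simprules mult.commute)

lemma poly_ring_power_closed:
  "p \<in> carrier (poly_ring n) \<Longrightarrow> p ^ t \<in> carrier (poly_ring n)"
  using monoid.nat_pow_closed[OF ring.is_monoid[OF cring.axioms(1)[OF cring_poly_ring]], of p n t]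
  by simp

lemma poly_ring_prod_closed:
  assumes "\<And>i. i \<in> S \<Longrightarrow> p i \<in> carrier (poly_ring n)"
  shows "(\<Prod>i \<in> S. p i) \<in> carrier (poly_ring n)"
  using assms
proof (induction S rule: infinite_finite_induct)
  case (insert s S)
  then show ?case
    using cring.cring_simprules(5)[OF cring_poly_ring, of "p s" n "prod p S"] by simp
qed (simp_all add: carrier_poly_ring)

lemma single_mem_poly_ring:
  "Poly_Mapping.keys m \<subseteq> {..<n} \<Longrightarrow> Poly_Mapping.single m c \<in> carrier (poly_ring n)"
  by (simp add: carrier_poly_ring)

lemma var_mem_poly_ring: "i < n \<Longrightarrow> var i \<in> carrier (poly_ring n)"
  unfolding var_def by (rule single_mem_poly_ring) simp

lemma var_power: "var i ^ t = Poly_Mapping.single (Poly_Mapping.single i t) 1"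
  by (induction t) (simp_all add: var_def mult_single flip: single_add)

lemma lookup_hom_part:
  "Poly_Mapping.lookup (hom_part d p) m =
    (if total_degree m = d then Poly_Mapping.lookup p m else 0)"
  by (auto simp: hom_part_def lookup_sum lookup_single when_def in_keys_iff)

lemma poly_mapping_sum_keys:
  "(\<Sum>m \<in> Poly_Mapping.keys p. Poly_Mapping.single m (Poly_Mapping.lookup p m)) = p"
  by (rule poly_mapping_eqI) (auto simp: lookup_sum lookup_single when_def in_keys_iff)

lemma ideal_sum_mem:
  assumes "ideal J (poly_ring n)" "\<And>i. i \<in> A \<Longrightarrow> f i \<in> J"
  shows "sum f A \<in> J"
  using assms(2)
proof (induction A rule: infinite_finite_induct)
  case (insert x F)
  then show ?case
    using additive_subgroup.a_closed[OF ideal.axioms(1)[OF assms(1)], of "f x" "sum f F"] by simp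
qed (use additive_subgroup.zero_closed[OF ideal.axioms(1)[OF assms(1)]] in simp_all)

lemma ideal_single_mem:
  assumes "ideal J (poly_ring n)" "Poly_Mapping.single m 1 \<in> J"
  shows "Poly_Mapping.single m c \<in> J"
  \<comment> \<open>The scalar \<open>c\<close> acts as the constant polynomial with exponent vector
    0.\<close>
  using ideal.I_l_closed[OF assms, of "Poly_Mapping.single 0 c"]
  by (simp add: single_mem_poly_ring mult_single)

lemma ideal_mem_if_keys:
  assumes "ideal J (poly_ring n)"
    and "\<And>m. m \<in> Poly_Mapping.keys p \<Longrightarrow> Poly_Mapping.single m 1 \<in> J"
  shows "p \<in> J"
proof -
  have "(\<Sum>m \<in> Poly_Mapping.keys p. Poly_Mapping.single m (Poly_Mapping.lookup p m)) \<in> J"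
    by (rule ideal_sum_mem[OF assms(1)]) (rule ideal_single_mem[OF assms(1) assms(2)])
  then show ?thesis
    by (simp only: poly_mapping_sum_keys)
qed

text \<open>A homogeneous polynomial is a combination of the monomials in its support. This is what
  finally allows two ideals with the same monomials to be compared. For negative \<open>d\<close>
  the component is {0} and both sides hold.\<close>

lemma poly_comp_subset_iff:
  assumes "ideal J (poly_ring n)"
  shows "poly_comp n d \<subseteq> (J :: 'k::field mpoly set) \<longleftrightarrow>
    (\<forall>m. Poly_Mapping.keys m \<subseteq> {..<n} \<longrightarrow> int (total_degree m) = d \<longrightarrow> Poly_Mapping.single m 1 \<in> J)"
proof
  show "\<forall>m. Poly_Mapping.keys m \<subseteq> {..<n} \<longrightarrow> int (total_degree m) = d \<longrightarrow>
      Poly_Mapping.single m 1 \<in> J" if "poly_comp n d \<subseteq> J"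
    using that by (auto simp: poly_comp_def single_mem_poly_ring)
  show "poly_comp n d \<subseteq> J"
    if "\<forall>m. Poly_Mapping.keys m \<subseteq> {..<n} \<longrightarrow> int (total_degree m) = d \<longrightarrow>
      Poly_Mapping.single m 1 \<in> J"
    using that ideal_mem_if_keys[OF assms] by (auto simp: poly_comp_def carrier_poly_ring)
qed

text \<open>The set is the \<open>d\<close>-th power of (x_1, ..., x_n); it absorbs products because
  degrees of monomials add.\<close>

lemma ideal_degree_ge:
  "ideal {p \<in> carrier (poly_ring n). \<forall>m \<in> Poly_Mapping.keys p. d \<le> total_degree m}
    (poly_ring n :: 'k::field mpoly ring)"
  (is "ideal ?H ?R")
proof -
  interpret cring ?R
    by (rule cring_poly_ring)
  have mult: "p * q \<in> ?H" if "p \<in> ?H" "q \<in> carrier ?R" for p q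
  proof -
    have "p * q \<in> carrier ?R"
      using that m_closed[of p q] by simp
    moreover have "d \<le> total_degree m" if "m \<in> Poly_Mapping.keys (p * q)" for m
      using that keys_mult[of p q] \<open>p \<in> ?H\<close> by (force simp: total_degree_add)
    ultimately show ?thesis
      by simp
  qed
  show ?thesis
  proof (rule idealI)
    show "subgroup ?H (add_monoid ?R)"
    proof (rule subgroup.intro)
      show "x \<otimes>\<^bsub>add_monoid ?R\<^esub> y \<in> ?H" if "x \<in> ?H" "y \<in> ?H" for x y
        using that keys_add[of x y] a_closed[of x y] by auto
      show "inv\<^bsub>add_monoid ?R\<^esub> x \<in> ?H" if "x \<in> ?H" for x
      proof -
        have "- x \<in> ?H"
          using that by (auto simp: carrier_poly_ring)
        moreover have "\<ominus>\<^bsub>?R\<^esub> x = - x"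
          using that by (intro minus_equality) (auto simp: carrier_poly_ring)
        ultimately show ?thesis
          by (simp add: a_inv_def)
      qed
    qed (auto simp: carrier_poly_ring)
    show "a \<otimes>\<^bsub>?R\<^esub> x \<in> ?H" if "x \<in> ?H" "a \<in> carrier ?R" for a x
      using mult[OF that] by (simp only: poly_ring_simps mult.commute)
    show "x \<otimes>\<^bsub>?R\<^esub> a \<in> ?H" if "x \<in> ?H" "a \<in> carrier ?R" for a x
      using mult[OF that] by (simp only: poly_ring_simps)
  qed (rule ring_axioms)
qed

section \<open>Monomials of large degree under an Artinian quotient\<close>

lemma artinian_quot_monomials_mem:
  assumes I: "graded_ideal n I" and J: "ideal J (poly_ring n)" "J \<subseteq> I"
    and art: "artinian_ring (poly_ring n Quot J)"
  obtains N where "\<And>m. Poly_Mapping.keys m \<subseteq> {..<n} \<Longrightarrow> N \<le> total_degree m \<Longrightarrow>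
    Poly_Mapping.single m 1 \<in> (I :: 'k::field mpoly set)"
proof -
  let ?R = "poly_ring n :: 'k mpoly ring"
  interpret cring ?R
    by (rule cring_poly_ring)
  interpret J: ideal J ?R
    by (rule J(1))
  define H where "H d = {p \<in> carrier ?R. \<forall>m \<in> Poly_Mapping.keys p. d \<le> total_degree m}" for d
  \<comment> \<open>The powers of (x_1, ..., x_n) are pushed to the quotient, where their images
    form a descending chain of ideals.\<close>
  have "ideal ((+>\<^bsub>?R\<^esub>) J ` H d) (?R Quot J)" for d
    unfolding H_def by (intro ring_ideal_imp_quot_ideal J ideal_degree_ge)
  moreover have "(+>\<^bsub>?R\<^esub>) J ` H (Suc d) \<subseteq> (+>\<^bsub>?R\<^esub>) J ` H d" for d
    by (rule image_mono) (auto simp: H_def)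
  ultimately have "\<exists>N. \<forall>d \<ge> N. (+>\<^bsub>?R\<^esub>) J ` H d = (+>\<^bsub>?R\<^esub>) J ` H N"
    using art unfolding artinian_ring_def
    by (elim conjE allE[of _ "\<lambda>d. (+>\<^bsub>?R\<^esub>) J ` H d"]) blast
  then obtain N where N: "\<And>d. d \<ge> N \<Longrightarrow> (+>\<^bsub>?R\<^esub>) J ` H d = (+>\<^bsub>?R\<^esub>) J ` H N"
    by blast
  show ?thesis
  proof
    fix m :: "nat \<Rightarrow>\<^sub>0 nat"
    let ?d = "total_degree m" and ?x = "Poly_Mapping.single m (1 :: 'k)"
    assume m: "Poly_Mapping.keys m \<subseteq> {..<n}" "N \<le> ?d"
    then have x: "?x \<in> H ?d"
      by (auto simp: H_def single_mem_poly_ring)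
    \<comment> \<open>From \<open>N\<close> on the images for \<open>?d\<close> and
      \<open>Suc ?d\<close> agree, so the monomial is congruent modulo \<open>J\<close> to some
      \<open>r\<close> with terms of larger degree only.\<close>
    have "J +>\<^bsub>?R\<^esub> ?x \<in> (+>\<^bsub>?R\<^esub>) J ` H (Suc ?d)"
      using imageI[OF x, of "(+>\<^bsub>?R\<^esub>) J"] N[OF m(2)] N[of "Suc ?d"] m(2) by simp
    then obtain r where r: "r \<in> H (Suc ?d)" "J +>\<^bsub>?R\<^esub> ?x = J +>\<^bsub>?R\<^esub> r"
      by blast
    have "?x \<in> J +>\<^bsub>?R\<^esub> r"
      using J.a_rcos_self[of ?x] r(2) m(1) by (simp add: single_mem_poly_ring)
    then obtain p where p: "p \<in> J" "?x = p + r"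
      by (auto simp: a_r_coset_def')
    \<comment> \<open>Since \<open>r\<close> has no term of degree \<open>?d\<close>, the part of
      \<open>p\<close> in that degree is the whole monomial. As \<open>p\<close> lies in
      \<open>J\<close>, hence in \<open>I\<close>, gradedness of \<open>I\<close> applies to
      it.\<close>
    have "Poly_Mapping.lookup r m' = 0" if "total_degree m' = ?d" for m'
      using r(1) that by (force simp: H_def in_keys_iff)
    moreover have "Poly_Mapping.lookup p m' = Poly_Mapping.lookup ?x m' - Poly_Mapping.lookup r m'" for m'
      by (simp add: p(2) lookup_add)
    ultimately have "Poly_Mapping.lookup (hom_part ?d p) m' = Poly_Mapping.lookup ?x m'" for m'
      by (cases "total_degree m' = ?d") (auto simp: lookup_hom_part lookup_single when_def)
    then have "hom_part ?d p = ?x"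
      by (rule poly_mapping_eqI)
    then show "?x \<in> I"
      using I J(2) p(1) by (metis graded_ideal_def subsetD)
  qed
qed

section \<open>Quotients by ideals containing all monomials of large degree\<close>

text \<open>Each exponent is at most the total degree, so restriction to the first \<open>n\<close>
  indices embeds the set into the finitely many functions from \<open>{..<n}\<close> to
  \<open>{..<N}\<close>.\<close>

lemma finite_bounded_exponents:
  "finite {m. Poly_Mapping.keys m \<subseteq> {..<n} \<and> total_degree m < N}"
proof (rule finite_imageD)
  let ?A = "{m. Poly_Mapping.keys m \<subseteq> {..<n} \<and> total_degree m < N}"
  show "inj_on (\<lambda>m. restrict (Poly_Mapping.lookup m) {..<n}) ?A"
  proof (rule inj_onI)
    fix a b
    assume ab: "a \<in> ?A" "b \<in> ?A"
      "restrict (Poly_Mapping.lookup a) {..<n} = restrict (Poly_Mapping.lookup b) {..<n}"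
    have "Poly_Mapping.lookup a i = Poly_Mapping.lookup b i" for i
    proof (cases "i < n")
      case True
      then show ?thesis
        using fun_cong[OF ab(3), of i] by simp
    next
      case False
      then have "i \<notin> Poly_Mapping.keys a" "i \<notin> Poly_Mapping.keys b"
        using ab by auto
      then show ?thesis
        by (simp add: in_keys_iff)
    qed
    then show "a = b"
      by (rule poly_mapping_eqI)
  qed
  have "Poly_Mapping.lookup m i \<le> total_degree m" for m i
    unfolding total_degree_def
    by (cases "i \<in> Poly_Mapping.keys m") (auto simp: in_keys_iff intro: member_le_sum)
  then have "Poly_Mapping.lookup m i < N" if "m \<in> ?A" for m i
    using that order_le_less_trans by blast
  then have "(\<lambda>m. restrict (Poly_Mapping.lookup m) {..<n}) ` ?A \<subseteq> {..<n} \<rightarrow>\<^sub>E {..<N}"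
    unfolding restrict_def by (auto split: if_splits)
  then show "finite ((\<lambda>m. restrict (Poly_Mapping.lookup m) {..<n}) ` ?A)"
    by (rule finite_subset) (auto intro: finite_PiE)
qed

text \<open>The condition says that \<open>J\<close> contains the \<open>N\<close>-th power of (x_1,
  ..., x_n). The bound is a parameter because it serves again as nilpotency exponent of the
  variables modulo \<open>J\<close>, and because the same bound works for an ideal and its monomial
  ideal.\<close>

locale cofinite_ideal =
  fixes n :: nat and J :: "'k::field mpoly set" and N :: nat
  assumes ideal_J: "ideal J (poly_ring n)"
    and monomials_mem: "\<And>m. Poly_Mapping.keys m \<subseteq> {..<n} \<Longrightarrow> N \<le> total_degree m \<Longrightarrow>
      Poly_Mapping.single m 1 \<in> J"
begin

abbreviation "R \<equiv> poly_ring n :: 'k mpoly ring"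

sublocale R: cring R
  by (rule cring_poly_ring)

sublocale J: ideal J R
  by (rule ideal_J)

sublocale Q: cring "R Quot J"
  by (rule J.quotient_is_cring[OF cring_poly_ring])

text \<open>Ideals of the quotient lift to ideals \<open>D i\<close> containing \<open>J\<close>.
  Such an ideal is determined by its intersection with the span of the monomials of degree below
  \<open>N\<close>, and in that finite-dimensional space descending chains stop.\<close>

lemma artinian_quot: "artinian_ring (R Quot J)"
  unfolding artinian_ring_def
proof (intro conjI allI impI)
  show "cring (R Quot J)"
    by (rule Q.cring_axioms)
  fix C :: "nat \<Rightarrow> 'k mpoly set set"
  assume C: "\<forall>i. ideal (C i) (R Quot J) \<and> C (Suc i) \<subseteq> C i"
  have "\<exists>D. ideal D R \<and> J \<subseteq> D \<and> C i = (+>\<^bsub>R\<^esub>) J ` D" for i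
  proof -
    have "C i \<in> (\<lambda>D. (+>\<^bsub>R\<^esub>) J ` D) ` {D. ideal D R \<and> J \<subseteq> D}"
      using bij_betw_imp_surj_on[OF R.quot_ideal_correspondence[OF ideal_J]] C by simp
    then show ?thesis
      by (rule imageE) auto
  qed
  then obtain D where D: "\<And>i. ideal (D i) R" "\<And>i. J \<subseteq> D i" "\<And>i. C i = (+>\<^bsub>R\<^esub>) J ` D i"
    by metis
  have D_add: "p + q \<in> D i" if "p \<in> D i" "q \<in> D i" for p q i
    using additive_subgroup.a_closed[OF ideal.axioms(1)[OF D(1)], of p i q] that by simp
  have D_mult: "p * q \<in> D i" if "p \<in> carrier R" "q \<in> D i" for p q i
    using ideal.I_l_closed[OF D(1), of q i p] that by simp
  \<comment> \<open>Inclusion lifts from the images because changing the representative of a coset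
    adds an element of \<open>J\<close>, which lies in \<open>D i\<close>.\<close>
  have desc: "D (Suc i) \<subseteq> D i" for i
  proof
    fix p assume p: "p \<in> D (Suc i)"
    then have "J +>\<^bsub>R\<^esub> p \<in> (+>\<^bsub>R\<^esub>) J ` D i"
      using C D(3) by blast
    then obtain q where q: "q \<in> D i" "J +>\<^bsub>R\<^esub> p = J +>\<^bsub>R\<^esub> q"
      by blast
    have "p \<in> J +>\<^bsub>R\<^esub> q"
      using J.a_rcos_self[of p] q(2) ideal.Icarr[OF D(1) p] by simp
    then show "p \<in> D i"
      using q(1) D(2)[of i] D_add by (auto simp: a_r_coset_def')
  qed
  \<comment> \<open>Scalars act as constant polynomials. The vector space is the whole type, with
    infinitely many variables; finite dimension enters only through the span of
    \<open>B\<close>.\<close>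
  define sc :: "'k \<Rightarrow> 'k mpoly \<Rightarrow> 'k mpoly" where "sc c p = Poly_Mapping.single 0 c * p" for c p
  interpret V: vector_space sc
  proof
    show "sc a (sc b x) = sc (a * b) x" for a b x
      by (simp add: sc_def mult_single flip: mult.assoc)
  qed (simp_all add: sc_def distrib_left distrib_right single_add)
  define B where "B = (\<lambda>m. Poly_Mapping.single m (1 :: 'k)) `
    {m. Poly_Mapping.keys m \<subseteq> {..<n} \<and> total_degree m < N}"
  have "V.subspace (D i)" for i
    using D_add D_mult additive_subgroup.zero_closed[OF ideal.axioms(1)[OF D(1)], of i]
    by (intro V.subspaceI) (auto simp: sc_def single_mem_poly_ring)
  then have "V.subspace (D i \<inter> V.span B)" for i
    by (simp add: V.subspace_inter V.subspace_span)
  moreover have "D (Suc i) \<inter> V.span B \<subseteq> D i \<inter> V.span B" for i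
    using desc[of i] by blast
  moreover have "finite B"
    unfolding B_def by (rule finite_imageI) (rule finite_bounded_exponents)
  ultimately have "\<exists>K. \<forall>i \<ge> K. D i \<inter> V.span B = D K \<inter> V.span B"
    by (intro V.descending_subspaces_stationary[of _ B]) simp_all
  then obtain K where K: "\<And>i. i \<ge> K \<Longrightarrow> D i \<inter> V.span B = D K \<inter> V.span B"
    by blast
  have mono: "D i \<subseteq> D j" if "j \<le> i" for i j
    using lift_Suc_antimono_le[of D] desc that by blast
  have "D K \<subseteq> D i" if i: "i \<ge> K" for i
  proof
    fix p assume p: "p \<in> D K"
    let ?t = "\<lambda>m. Poly_Mapping.single m (Poly_Mapping.lookup p m)"
    let ?lo = "{m \<in> Poly_Mapping.keys p. total_degree m < N}"
    let ?hi = "{m \<in> Poly_Mapping.keys p. N \<le> total_degree m}"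
    have keys: "Poly_Mapping.keys m \<subseteq> {..<n}" if "m \<in> Poly_Mapping.keys p" for m
      using ideal.Icarr[OF D(1) p] that by (simp add: carrier_poly_ring)
    have "?lo \<union> ?hi = Poly_Mapping.keys p"
      by auto
    then have "p = sum ?t (?lo \<union> ?hi)"
      by (simp only: poly_mapping_sum_keys)
    also have "\<dots> = sum ?t ?lo + sum ?t ?hi"
      by (rule sum.union_disjoint) auto
    finally have split: "p = sum ?t ?lo + sum ?t ?hi" .
    have hi: "sum ?t ?hi \<in> J"
    proof (rule ideal_sum_mem[OF ideal_J])
      show "?t m \<in> J" if "m \<in> ?hi" for m
        by (rule ideal_single_mem[OF ideal_J monomials_mem]) (use that keys in auto)
    qed
    have "?t m \<in> V.span B" if "m \<in> ?lo" for m
    proof -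
      have "Poly_Mapping.single m 1 \<in> B"
        using that keys unfolding B_def by (intro imageI) simp
      then have "sc (Poly_Mapping.lookup p m) (Poly_Mapping.single m 1) \<in> V.span B"
        by (intro V.span_scale V.span_base)
      then show ?thesis
        by (simp add: sc_def mult_single)
    qed
    then have lo: "sum ?t ?lo \<in> V.span B"
      by (rule V.span_sum)
    obtain a b where ab: "p = a + b" "a \<in> V.span B" "b \<in> J"
      by (rule that[OF split lo hi])
    \<comment> \<open>As \<open>J\<close> lies in every \<open>D i\<close>, subtracting
      \<open>b\<close> keeps the low part \<open>a\<close> in \<open>D K\<close>; stationarity moves
      \<open>a\<close> into \<open>D i\<close>, where \<open>b\<close> can be added back.\<close>
    have "Poly_Mapping.single 0 (- 1) * b \<in> D K"
      using ab(3) D(2)[of K] by (intro D_mult) (auto simp: single_mem_poly_ring)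
    moreover have "Poly_Mapping.single 0 (- 1) * b = - b"
      using V.scale_minus_left[of 1 b] by (simp add: sc_def)
    ultimately have "a \<in> D K"
      using D_add[OF p, of "- b"] ab(1) by simp
    then have "a \<in> D i"
      using K[OF i] ab(2) by blast
    then show "p \<in> D i"
      using ab(1,3) D(2)[of i] D_add by blast
  qed
  then have "D i = D K" if "i \<ge> K" for i
    using mono[OF that] that by blast
  then show "\<exists>N. \<forall>i \<ge> N. C i = C N"
    using D(3) by metis
qed


section \<open>The Cech complex and the regularity of the quotient\<close>

abbreviation "M \<equiv> quot_module n J"

lemma quot_module_simps [simp]:
  "carrier M = carrier (R Quot J)" "zero M = zero (R Quot J)" "add M = add (R Quot J)"
  "smult M p X = (J +>\<^bsub>R\<^esub> p) \<otimes>\<^bsub>R Quot J\<^esub> X"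
  "gr_comp M d = (\<lambda>p. J +>\<^bsub>R\<^esub> p) ` poly_comp n d"
  by (simp_all add: quot_module_def)

lemma coset_closed: "p \<in> carrier R \<Longrightarrow> J +>\<^bsub>R\<^esub> p \<in> carrier (R Quot J)"
  by (rule ring_hom_closed[OF J.rcos_ring_hom])

lemma coset_eq_zero_iff:
  assumes "p \<in> carrier R"
  shows "J +>\<^bsub>R\<^esub> p = \<zero>\<^bsub>R Quot J\<^esub> \<longleftrightarrow> p \<in> J"
  using J.a_rcos_const[of p] J.a_rcos_self[OF assms] by (auto simp: FactRing_def)

lemma coset_one: "J +>\<^bsub>R\<^esub> 1 = \<one>\<^bsub>R Quot J\<^esub>"
  by (simp add: FactRing_def)

lemma smult_closed:
  "p \<in> carrier R \<Longrightarrow> u \<in> carrier (R Quot J) \<Longrightarrow> smult M p u \<in> carrier (R Quot J)"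
  using Q.m_closed[OF coset_closed] by simp

lemma gr_comp_closed: "gr_comp M d \<subseteq> carrier (R Quot J)"
  using coset_closed by (auto simp: poly_comp_def)

lemma zero_mem_gr_comp: "\<zero>\<^bsub>R Quot J\<^esub> \<in> gr_comp M d"
proof -
  have "\<zero>\<^bsub>R Quot J\<^esub> = J +>\<^bsub>R\<^esub> 0"
    using coset_eq_zero_iff[of 0] J.zero_closed R.zero_closed by simp
  then show ?thesis
    by (auto simp: poly_comp_def carrier_poly_ring)
qed

lemma var_prod_closed: "S \<subseteq> {..<n} \<Longrightarrow> (\<Prod>i \<in> S. var i) \<in> carrier R"
  by (intro poly_ring_prod_closed var_mem_poly_ring) auto

text \<open>The power has a factor \<open>var s ^ N\<close>, a monomial of degree \<open>N\<close>.
  The surplus \<open>k\<close> matches the exponents \<open>t + l\<close> and \<open>t + k\<close>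
  in \<open>frac_class\<close>.\<close>

lemma var_prod_power_mem:
  assumes "S \<subseteq> {..<n}" "S \<noteq> {}"
  shows "(\<Prod>i \<in> S. var i) ^ (N + k) \<in> J"
proof -
  obtain s where s: "s \<in> S" "s < n"
    using assms by auto
  have "(\<Prod>i \<in> S. var i :: 'k mpoly) = var s * (\<Prod>i \<in> S - {s}. var i)"
    using s(1) finite_subset[OF assms(1)] by (simp add: prod.remove)
  then have "(\<Prod>i \<in> S. var i :: 'k mpoly) ^ (N + k) =
      (\<Prod>i \<in> S - {s}. var i) ^ N * (\<Prod>i \<in> S. var i) ^ k * var s ^ N"
    by (simp add: power_add power_mult_distrib mult_ac)
  moreover have "var s ^ N \<in> J"
    unfolding var_power using s(2) by (intro monomials_mem) (auto simp: total_degree_def)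
  moreover have "(\<Prod>i \<in> S - {s}. var i) ^ N * (\<Prod>i \<in> S. var i) ^ k \<in> carrier R"
    using assms(1) R.m_closed[of "(\<Prod>i \<in> S - {s}. var i) ^ N" "(\<Prod>i \<in> S. var i) ^ k"]
    by (simp add: poly_ring_power_closed var_prod_closed subset_insertI2 Diff_subset_conv)
  ultimately show ?thesis
    using J.I_l_closed[of "var s ^ N"] by simp
qed

text \<open>The localization at a nilpotent element collapses to a single class.\<close>

lemma frac_class_var_prod:
  assumes "S \<subseteq> {..<n}" "S \<noteq> {}" "u \<in> carrier (R Quot J)"
  shows "frac_class R M (\<Prod>i \<in> S. var i) u k = carrier (R Quot J) \<times> UNIV"
proof -
  \<comment> \<open>With the witness \<open>t = N\<close>, both sides of the equation defining
    equality of fractions vanish.\<close>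
  have "smult M ((\<Prod>i \<in> S. var i) [^]\<^bsub>R\<^esub> (N + l)) v = \<zero>\<^bsub>R Quot J\<^esub>"
    if "v \<in> carrier (R Quot J)" for v l
    using that var_prod_power_mem[OF assms(1,2), of l]
      coset_eq_zero_iff[OF J.Icarr[OF var_prod_power_mem[OF assms(1,2), of l]]]
    by simp
  then show ?thesis
    using assms(3) by (auto simp: frac_class_def intro!: exI[of _ N])
qed

text \<open>Powers of 1 act as the identity, so a fraction is its numerator with an arbitrary
  exponent.\<close>

lemma frac_class_one:
  assumes "u \<in> carrier (R Quot J)"
  shows "frac_class R M 1 u k = {u} \<times> UNIV"
  using assms by (auto simp: frac_class_def coset_one)

lemma cech_loc_sel:
  fixes S
  defines "f \<equiv> \<Prod>i \<in> S. var i"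
  shows "carrier (cech_loc n M S) = {frac_class R M f u k | u k. u \<in> carrier (R Quot J)}"
    and "zero (cech_loc n M S) = frac_class R M f \<zero>\<^bsub>R Quot J\<^esub> 0"
    and "add (cech_loc n M S) X Y = (\<Union>(u, k) \<in> X. \<Union>(v, l) \<in> Y.
      frac_class R M f (smult M (f ^ l) u \<oplus>\<^bsub>R Quot J\<^esub> smult M (f ^ k) v) (k + l))"
    and "smult (cech_loc n M S) p X = (\<Union>(u, k) \<in> X. frac_class R M f (smult M p u) k)"
    and "gr_comp (cech_loc n M S) j =
      {frac_class R M f u k | u k. u \<in> gr_comp M (j + int (card S * k))}"
  by (simp_all add: cech_loc_def localization_def f_def)

text \<open>Every fraction has the same class \<open>E\<close>, so this localization is the zero
  module with \<open>E\<close> as its only element.\<close>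

lemma cech_loc_nonempty:
  assumes S: "S \<subseteq> {..<n}" "S \<noteq> {}"
  defines "E \<equiv> carrier (R Quot J) \<times> (UNIV :: nat set)"
  shows "carrier (cech_loc n M S) = {E}"
    and "zero (cech_loc n M S) = E"
    and "add (cech_loc n M S) E E = E"
    and "p \<in> carrier R \<Longrightarrow> smult (cech_loc n M S) p E = E"
    and "gr_comp (cech_loc n M S) j = {E}"
proof -
  let ?f = "\<Prod>i \<in> S. var i"
  have frac: "frac_class R M ?f u k = E" if "u \<in> carrier (R Quot J)" for u k
    unfolding E_def by (rule frac_class_var_prod[OF S that])
  \<comment> \<open>The set \<open>A k\<close> of numerators may depend on \<open>k\<close>, as the
    graded components require; zero over exponent 0 shows that some fraction exists.\<close>
  have collapse: "{g u k | u k. u \<in> A k} = {E}"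
    if "\<And>u k. u \<in> A k \<Longrightarrow> g u k = E" "\<zero>\<^bsub>R Quot J\<^esub> \<in> A 0"
    for g :: "'k mpoly set \<Rightarrow> nat \<Rightarrow> ('k mpoly set \<times> nat) set" and A
  proof (intro equalityI subsetI)
    show "x \<in> {E}" if "x \<in> {g u k | u k. u \<in> A k}" for x
      using that \<open>\<And>u k. u \<in> A k \<Longrightarrow> g u k = E\<close> by blast
    have "E = g \<zero>\<^bsub>R Quot J\<^esub> 0"
      by (rule that(1)[OF that(2), symmetric])
    then show "x \<in> {g u k | u k. u \<in> A k}" if "x \<in> {E}" for x
      using that \<open>\<zero>\<^bsub>R Quot J\<^esub> \<in> A 0\<close> by blast
  qed
  have "E \<noteq> {}"
    using Q.zero_closed by (auto simp: E_def)
  have E: "fst x \<in> carrier (R Quot J)" if "x \<in> E" for x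
    using that by (auto simp: E_def)
  show "carrier (cech_loc n M S) = {E}"
    unfolding cech_loc_sel by (rule collapse[OF frac Q.zero_closed])
  show "zero (cech_loc n M S) = E"
    unfolding cech_loc_sel by (rule frac[OF Q.zero_closed])
  have closed: "smult M (?f ^ t) w \<in> carrier (R Quot J)" if "w \<in> carrier (R Quot J)" for w t
    by (intro smult_closed poly_ring_power_closed var_prod_closed that S)
  show "add (cech_loc n M S) E E = E"
    unfolding cech_loc_sel split_beta
    by (intro SUP_eq_const \<open>E \<noteq> {}\<close> frac Q.a_closed closed E)
  show "smult (cech_loc n M S) p E = E" if "p \<in> carrier R"
    unfolding cech_loc_sel split_beta by (intro SUP_eq_const \<open>E \<noteq> {}\<close> frac smult_closed that E)
  show "gr_comp (cech_loc n M S) j = {E}"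
    unfolding cech_loc_sel
    by (rule collapse[OF frac zero_mem_gr_comp]) (rule subsetD[OF gr_comp_closed])
qed

text \<open>The empty product is 1, of degree 0, so this localization is \<open>M\<close> with its
  grading; \<open>u\<close> is encoded as \<open>{u} \<times> UNIV\<close>.\<close>

lemma cech_loc_empty:
  shows "zero (cech_loc n M {}) = {\<zero>\<^bsub>R Quot J\<^esub>} \<times> UNIV"
    and "u \<in> carrier (R Quot J) \<Longrightarrow> v \<in> carrier (R Quot J) \<Longrightarrow>
      add (cech_loc n M {}) ({u} \<times> UNIV) ({v} \<times> UNIV) = {u \<oplus>\<^bsub>R Quot J\<^esub> v} \<times> UNIV"
    and "gr_comp (cech_loc n M {}) j = (\<lambda>u. {u} \<times> UNIV) ` gr_comp M j"
proof -
  show "zero (cech_loc n M {}) = {\<zero>\<^bsub>R Quot J\<^esub>} \<times> UNIV"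
    by (simp add: cech_loc_sel frac_class_one)
  show "add (cech_loc n M {}) ({u} \<times> UNIV) ({v} \<times> UNIV) = {u \<oplus>\<^bsub>R Quot J\<^esub> v} \<times> UNIV"
    if "u \<in> carrier (R Quot J)" "v \<in> carrier (R Quot J)"
  proof -
    have frac: "frac_class R M 1 ((J +>\<^bsub>R\<^esub> 1) \<otimes>\<^bsub>R Quot J\<^esub> u \<oplus>\<^bsub>R Quot J\<^esub> (J +>\<^bsub>R\<^esub> 1) \<otimes>\<^bsub>R Quot J\<^esub> v) k =
        {u \<oplus>\<^bsub>R Quot J\<^esub> v} \<times> UNIV" for k
      using that by (simp add: frac_class_one coset_one)
    have range: "{w} \<times> UNIV = range (Pair w)" for w :: "'k mpoly set"
      by auto
    show ?thesis
      unfolding cech_loc_sel prod.empty range by (simp add: frac[unfolded range])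
  qed
  have frac: "frac_class R M 1 u k = {u} \<times> UNIV" if "u \<in> gr_comp M j" for u k
    by (rule frac_class_one[OF subsetD[OF gr_comp_closed that]])
  have "gr_comp (cech_loc n M {}) j = (\<Union>u \<in> gr_comp M j. range (frac_class R M 1 u))"
    unfolding cech_loc_sel by (auto simp del: quot_module_simps)
  also have "\<dots> = (\<Union>u \<in> gr_comp M j. {{u} \<times> UNIV})"
  proof (rule SUP_cong[OF refl])
    show "range (frac_class R M 1 u) = {{u} \<times> UNIV}" if "u \<in> gr_comp M j" for u
      using frac[OF that] by auto
  qed
  finally show "gr_comp (cech_loc n M {}) j = (\<lambda>u. {u} \<times> UNIV) ` gr_comp M j"
    by (simp only: UNION_singleton_eq_range)
qed

lemma abelian_monoid_cech_loc:
  assumes "S \<subseteq> {..<n}" "S \<noteq> {}"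
  shows "abelian_monoid (cech_loc n M S)"
  using cech_loc_nonempty[OF assms] by (intro abelian_monoidI) simp_all

text \<open>The target belongs to the nonempty face \<open>T\<close> and has a single element. Since
  \<open>X\<close> is nonempty, the union over its representatives is that element and not the empty
  set.\<close>

lemma cech_res_eq:
  assumes "T \<subseteq> {..<n}" "s \<in> T" "X \<noteq> {}" "X \<subseteq> carrier (R Quot J) \<times> UNIV"
  shows "cech_res n M T s X = carrier (R Quot J) \<times> UNIV"
proof -
  have "frac_class R M (\<Prod>i \<in> T. var i) ((var s ^ k) \<odot>\<^bsub>M\<^esub> u) k = carrier (R Quot J) \<times> UNIV"
    if "(u, k) \<in> X" for u k
    using that assms
    by (intro frac_class_var_prod smult_closed poly_ring_power_closed var_mem_poly_ring) auto
  then show ?thesis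
    using assms(3) unfolding cech_res_def by fastforce
qed

lemma gr_comp_cech_loc:
  assumes "S \<subseteq> {..<n}" "X \<in> gr_comp (cech_loc n M S) j"
  shows "X \<noteq> {}" "X \<subseteq> carrier (R Quot J) \<times> UNIV"
proof -
  have "X \<noteq> {} \<and> X \<subseteq> carrier (R Quot J) \<times> UNIV"
  proof (cases "S = {}")
    case True
    then show ?thesis
      using assms(2) gr_comp_closed unfolding True cech_loc_empty(3) by blast
  next
    case False
    then show ?thesis
      using assms(2) Q.zero_closed unfolding cech_loc_nonempty(5)[OF assms(1) False] by auto
  qed
  then show "X \<noteq> {}" "X \<subseteq> carrier (R Quot J) \<times> UNIV"
    by simp_all
qed

lemma minus_one_power_closed: "(- 1) ^ k \<in> carrier R"
  by (rule poly_ring_power_closed) (simp add: carrier_poly_ring)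

text \<open>A face with \<open>Suc i\<close> elements is nonempty, so each component of the
  differential takes values in a one-element module. What remains to check is that the alternating
  sum lies in its carrier.\<close>

lemma cech_d_eq:
  assumes c: "c \<in> cech_cochains n M i j"
  shows "cech_d n M i c = cech_zero n M (Suc i)"
proof -
  have "(\<Oplus>\<^bsub>cech_loc n M T\<^esub>s \<in> T.
      ((- 1) ^ card {t \<in> T. t < s}) \<odot>\<^bsub>cech_loc n M T\<^esub> cech_res n M T s (c (T - {s}))) =
      \<zero>\<^bsub>cech_loc n M T\<^esub>" if T: "T \<in> faces n (Suc i)" for T
  proof -
    have T': "T \<subseteq> {..<n}" "T \<noteq> {}" "card T = Suc i"
      using T by (auto simp: faces_def)
    interpret L: abelian_monoid "cech_loc n M T"
      by (rule abelian_monoid_cech_loc[OF T'(1,2)])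
    have "cech_res n M T s (c (T - {s})) = carrier (R Quot J) \<times> UNIV" if "s \<in> T" for s
    proof -
      have "T - {s} \<in> faces n i"
        using T' that finite_subset[OF T'(1)] by (auto simp: faces_def)
      then have "c (T - {s}) \<in> gr_comp (cech_loc n M (T - {s})) j"
        using c by (auto simp: cech_cochains_def)
      moreover have "T - {s} \<subseteq> {..<n}"
        using T'(1) by blast
      ultimately show ?thesis
        using that T'(1) gr_comp_cech_loc by (intro cech_res_eq)
    qed
    then have "(\<Oplus>\<^bsub>cech_loc n M T\<^esub>s \<in> T.
        ((- 1) ^ card {t \<in> T. t < s}) \<odot>\<^bsub>cech_loc n M T\<^esub> cech_res n M T s (c (T - {s})))
        \<in> carrier (cech_loc n M T)"
      by (intro L.finsum_closed) (simp add: cech_loc_nonempty[OF T'(1,2)] minus_one_power_closed)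
    then show ?thesis
      by (simp add: cech_loc_nonempty[OF T'(1,2)])
  qed
  then show ?thesis
    unfolding cech_d_def cech_zero_def by (rule restrict_ext)
qed

lemma cech_cocycles_carrier: "carrier (cech_cocycles n M i j) = cech_cochains n M i j"
  using cech_d_eq by (auto simp: cech_cocycles_def)

lemma cech_zero_mem: "cech_zero n M i \<in> cech_cochains n M i j"
proof -
  have "\<zero>\<^bsub>cech_loc n M S\<^esub> \<in> gr_comp (cech_loc n M S) j" if "S \<subseteq> {..<n}" for S
  proof (cases "S = {}")
    case True
    then show ?thesis
      using zero_mem_gr_comp by (simp add: cech_loc_empty del: quot_module_simps(5))
  next
    case False
    then show ?thesis
      using that by (simp add: cech_loc_nonempty)
  qed
  then show ?thesis
    by (auto simp: cech_zero_def cech_cochains_def faces_def)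
qed

lemma cech_coboundaries_eq: "cech_coboundaries n M i j = {cech_zero n M i}"
  using cech_zero_mem cech_d_eq by (force simp: cech_coboundaries_def split: nat.split)

text \<open>This computes the coset of \<open>c\<close> modulo the coboundaries, which consist of
  zero alone.\<close>

lemma cech_zero_add:
  assumes "c \<in> cech_cochains n M i j"
  shows "add (cech_cocycles n M i j) (cech_zero n M i) c = c"
proof -
  have c: "c S \<in> gr_comp (cech_loc n M S) j" if "S \<in> faces n i" for S
    using assms that by (auto simp: cech_cochains_def)
  have "\<zero>\<^bsub>cech_loc n M S\<^esub> \<oplus>\<^bsub>cech_loc n M S\<^esub> c S = c S" if S: "S \<in> faces n i" for S
  proof (cases "S = {}")
    case True
    then obtain u where "c S = {u} \<times> UNIV" "u \<in> carrier (R Quot J)"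
      using c[OF S] gr_comp_closed unfolding True cech_loc_empty(3) by blast
    then show ?thesis
      using True by (simp add: cech_loc_empty)
  next
    case False
    then show ?thesis
      using c[OF S] S by (simp add: cech_loc_nonempty faces_def)
  qed
  then have "add (cech_cocycles n M i j) (cech_zero n M i) c = restrict c (faces n i)"
    by (auto simp: cech_cocycles_def cech_zero_def restrict_def fun_eq_iff)
  also have "\<dots> = c"
    using assms unfolding cech_cochains_def by (rule PiE_restrict)
  finally show ?thesis .
qed

text \<open>All differentials vanish, so cohomology is the module of cochains, each wrapped as a
  singleton coset.\<close>

lemma carrier_local_cohomology:
  "carrier (local_cohomology n M i j) = (\<lambda>c. {c}) ` cech_cochains n M i j"
  using cech_zero_add
  by (auto simp: local_cohomology_def A_FactGroup_def FactGroup_def RCOSETS_def r_coset_def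
      cech_cocycles_carrier cech_coboundaries_eq)

text \<open>For \<open>i > 0\<close> all faces are nonempty and the zero cochain is the only one.
  For \<open>i = 0\<close> the empty face is the only face, and a cochain is an element of the
  degree \<open>j\<close> component of \<open>M\<close>.\<close>

lemma local_cohomology_nontrivial_iff:
  "carrier (local_cohomology n M i j) \<noteq> {\<one>\<^bsub>local_cohomology n M i j\<^esub>} \<longleftrightarrow>
    i = 0 \<and> \<not> poly_comp n j \<subseteq> J"
proof -
  have one: "\<one>\<^bsub>local_cohomology n M i j\<^esub> = {cech_zero n M i}"
    by (simp add: local_cohomology_def A_FactGroup_def FactGroup_def cech_coboundaries_eq)
  have "carrier (local_cohomology n M i j) \<noteq> {\<one>\<^bsub>local_cohomology n M i j\<^esub>} \<longleftrightarrow>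
      (\<exists>c \<in> cech_cochains n M i j. c \<noteq> cech_zero n M i)"
    using cech_zero_mem[of i j] unfolding one carrier_local_cohomology by auto
  also have "\<dots> \<longleftrightarrow> i = 0 \<and> \<not> poly_comp n j \<subseteq> J"
  proof (cases "i = 0")
    case True
    have faces: "faces n 0 = {{}}"
      using finite_subset[of _ "{..<n}"] by (auto simp: faces_def)
    have "(\<exists>c \<in> cech_cochains n M 0 j. c \<noteq> cech_zero n M 0) \<longleftrightarrow>
        (\<exists>u \<in> gr_comp M j. u \<noteq> \<zero>\<^bsub>R Quot J\<^esub>)"
    proof
      assume "\<exists>c \<in> cech_cochains n M 0 j. c \<noteq> cech_zero n M 0"
      then obtain c where c: "c \<in> cech_cochains n M 0 j" "c \<noteq> cech_zero n M 0"
        by blast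
      then have "c {} \<in> gr_comp (cech_loc n M {}) j"
        using PiE_mem[OF c(1)[unfolded cech_cochains_def faces], of "{}"] by simp
      then obtain u where u: "u \<in> gr_comp M j" "c {} = {u} \<times> UNIV"
        unfolding cech_loc_empty(3) by blast
      have "u \<noteq> \<zero>\<^bsub>R Quot J\<^esub>"
      proof
        assume "u = \<zero>\<^bsub>R Quot J\<^esub>"
        then have "c {} = cech_zero n M 0 {}"
          by (simp add: u(2) cech_zero_def faces cech_loc_empty)
        \<comment> \<open>Cochains are extensional, so agreement at the empty face suffices.\<close>
        then have "c = cech_zero n M 0"
          using PiE_ext[OF c(1)[unfolded cech_cochains_def faces]
              cech_zero_mem[of 0 j, unfolded cech_cochains_def faces]] by simp
        then show False
          using c(2) by simp
      qed
      then show "\<exists>u \<in> gr_comp M j. u \<noteq> \<zero>\<^bsub>R Quot J\<^esub>"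
        using u(1) by blast
    next
      assume "\<exists>u \<in> gr_comp M j. u \<noteq> \<zero>\<^bsub>R Quot J\<^esub>"
      then obtain u where u: "u \<in> gr_comp M j" "u \<noteq> \<zero>\<^bsub>R Quot J\<^esub>"
        by blast
      define c where "c = (\<lambda>S \<in> {{} :: nat set}. {u} \<times> (UNIV :: nat set))"
      have "c \<in> cech_cochains n M 0 j"
        using u(1) unfolding cech_cochains_def faces c_def
        by (auto simp: cech_loc_empty simp del: quot_module_simps)
      moreover have "c {} \<noteq> cech_zero n M 0 {}"
        using u(2) by (auto simp: c_def cech_zero_def faces cech_loc_empty)
      ultimately show "\<exists>c \<in> cech_cochains n M 0 j. c \<noteq> cech_zero n M 0"
        by metis
    qed
    also have "\<dots> \<longleftrightarrow> \<not> poly_comp n j \<subseteq> J"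
      using coset_eq_zero_iff by (auto simp: poly_comp_def)
    finally show ?thesis
      using True by simp
  next
    case False
    have "c = cech_zero n M i" if c: "c \<in> cech_cochains n M i j" for c
    proof (rule PiE_ext[OF c[unfolded cech_cochains_def]
          cech_zero_mem[of i j, unfolded cech_cochains_def]])
      fix S assume S: "S \<in> faces n i"
      then have "S \<subseteq> {..<n}" "S \<noteq> {}"
        using False by (auto simp: faces_def)
      then show "c S = cech_zero n M i S"
        using PiE_mem[OF c[unfolded cech_cochains_def] S] S
        by (simp add: cech_zero_def cech_loc_nonempty)
    qed
    then show ?thesis
      using False by blast
  qed
  finally show ?thesis .
qed

text \<open>Only cohomological degree 0 contributes, so \<open>i + j\<close> is just
  \<open>j\<close>: the regularity is the supremum of the degrees in which \<open>M\<close> is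
  nonzero.\<close>

lemma regularity_quot_module:
  "regularity n M = (SUP j \<in> {j. \<not> poly_comp n j \<subseteq> J}. ereal (of_int j))"
proof -
  have "{(i, j). carrier (local_cohomology n M i j) \<noteq> {\<one>\<^bsub>local_cohomology n M i j\<^esub>}} =
      Pair 0 ` {j. \<not> poly_comp n j \<subseteq> J}"
    unfolding local_cohomology_nontrivial_iff by auto
  then show ?thesis
    by (simp add: regularity_def image_image)
qed

end

section \<open>Comparison of an ideal with its monomial ideal\<close>

lemma ideal_mono_ideal:
  assumes "ideal I (poly_ring n)"
  shows "ideal (mono_ideal n I) (poly_ring n)" "mono_ideal n I \<subseteq> I"
    and "p \<in> I \<Longrightarrow> monomial p \<Longrightarrow> p \<in> mono_ideal n I"
proof -
  interpret cring "poly_ring n"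
    by (rule cring_poly_ring)
  have sub: "{p \<in> I. monomial p} \<subseteq> carrier (poly_ring n)"
    using additive_subgroup.a_subset[OF ideal.axioms(1)[OF assms]] by blast
  show "ideal (mono_ideal n I) (poly_ring n)"
    unfolding mono_ideal_def by (rule genideal_ideal[OF sub])
  show "mono_ideal n I \<subseteq> I"
    unfolding mono_ideal_def by (rule genideal_minimal[OF assms]) blast
  show "p \<in> mono_ideal n I" if "p \<in> I" "monomial p"
    using genideal_self[OF sub] that unfolding mono_ideal_def by blast
qed

theorem proposition3p1:
  fixes n :: nat and I :: "'k::field mpoly set"
  assumes "graded_ideal n I"
  shows "(artinian_ideal n I \<longleftrightarrow> artinian_ideal n (mono_ideal n I)) \<and>
    (artinian_ideal n I \<longrightarrow>
       regularity n (quot_module n I) = regularity n (quot_module n (mono_ideal n I)))"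
proof -
  let ?R = "poly_ring n :: 'k mpoly ring" and ?K = "mono_ideal n I"
  have I: "ideal I ?R"
    using assms by (simp add: graded_ideal_def)
  note K = ideal_mono_ideal[OF I]
  have single_iff: "Poly_Mapping.single m 1 \<in> ?K \<longleftrightarrow> Poly_Mapping.single m 1 \<in> I" for m
    using K(2,3) by (auto simp: monomial_def)
  \<comment> \<open>The condition on large degrees concerns monomials only, so it passes to
    \<open>?K\<close> with the same \<open>N\<close>.\<close>
  have cofinite_mono: "cofinite_ideal n ?K N" if "cofinite_ideal n I N" for N
    using that K(1) unfolding cofinite_ideal_def single_iff by blast
  have proper_iff: "?K \<noteq> carrier ?R \<longleftrightarrow> I \<noteq> carrier ?R"
  proof -
    have one: "1 \<in> carrier ?R"
      by (simp add: carrier_poly_ring)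
    have "L = carrier ?R \<longleftrightarrow> 1 \<in> L" if "ideal L ?R" for L
      using ideal.one_imp_carrier[OF that] one by (metis poly_ring_simps(2))
    \<comment> \<open>Properness is also a question about one monomial, since 1 has exponent vector
      0.\<close>
    moreover have "1 \<in> ?K \<longleftrightarrow> 1 \<in> I"
      using single_iff[of 0] by simp
    ultimately show ?thesis
      using I K(1) by simp
  qed
  \<comment> \<open>Applied with \<open>J = I\<close> for one implication and with
    \<open>J = ?K\<close> for the other; either way the bound is obtained for
    \<open>I\<close>.\<close>
  have cofinite: "\<exists>N. cofinite_ideal n I N"
    if J: "artinian_ring (?R Quot J)" "ideal J ?R" "J \<subseteq> I" for J
  proof -
    obtain N where "\<And>m. Poly_Mapping.keys m \<subseteq> {..<n} \<Longrightarrow> N \<le> total_degree m \<Longrightarrow>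
        Poly_Mapping.single m 1 \<in> I"
      using artinian_quot_monomials_mem[OF assms J(2,3,1)] by blast
    then have "cofinite_ideal n I N"
      using I by (simp add: cofinite_ideal_def)
    then show ?thesis ..
  qed
  have "artinian_ideal n I \<longleftrightarrow> artinian_ideal n ?K"
  proof
    assume art: "artinian_ideal n I"
    then obtain N where "cofinite_ideal n I N"
      using cofinite[OF _ I] by (auto simp: artinian_ideal_def)
    then show "artinian_ideal n ?K"
      using art K(1) proper_iff cofinite_ideal.artinian_quot[OF cofinite_mono]
      by (simp add: artinian_ideal_def)
  next
    assume art: "artinian_ideal n ?K"
    then obtain N where "cofinite_ideal n I N"
      using cofinite[OF _ K(1,2)] by (auto simp: artinian_ideal_def)
    then show "artinian_ideal n I"
      using art I proper_iff cofinite_ideal.artinian_quot by (simp add: artinian_ideal_def)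
  qed
  moreover have "regularity n (quot_module n I) = regularity n (quot_module n ?K)"
    if art: "artinian_ideal n I"
  proof -
    obtain N where N: "cofinite_ideal n I N"
      using cofinite[OF _ I] art by (auto simp: artinian_ideal_def)
    \<comment> \<open>Both regularities are suprema over the degrees of monomials outside the ideal,
      and \<open>I\<close> and \<open>?K\<close> contain the same monomials.\<close>
    show ?thesis
      unfolding cofinite_ideal.regularity_quot_module[OF N]
        cofinite_ideal.regularity_quot_module[OF cofinite_mono[OF N]]
        poly_comp_subset_iff[OF I] poly_comp_subset_iff[OF K(1)] single_iff ..
  qed
  ultimately show ?thesis
    by blast
qed

end
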